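(* Fix an integer $r\ge 1$ and let $\mathcal{T}_h$ be a shape-regular triangulation of $\Omega\subset\mathbb{R}^3$ into tetrahedra. For $K\in\mathcal{T}_h$ let $\bm{D}_h(K)=[P_{r-1}(K)]^3$ and let $\bm{B}_h^{\mathrm{curl}}(K)$ be the $\bm{H}(\mathrm{curl})$ bubble space on $K$ defined in the context. Then there is a constant $c>0$, independent of $h_K$, such that for every $K\in\mathcal{T}_h$ $$\inf_{0\ne \bm{q}_h\in \bm{D}_h(K)}\ \sup_{0\ne \bm{v}_h\in \bm{B}_h^{\mathrm{curl}}(K)}\ \frac{(\bm{v}_h,\bm{q}_h)_K}{\|\bm{v}_h\|_{0,K}\,\|\bm{q}_h\|_{0,K}}\ \ge\ c\ >0 .$$
   Context: $(\cdot,\cdot)_K$ and $\|\cdot\|_{0,K}$ are the $L^2$ inner product and norm on $K$ (for vector fields), $h_K$ is the diameter of $K$, and $P_{m}(K)$ is the space of polynomials of degree at most $m$ on $K$. Constants may depend on the shape-regularity of the triangulation and on the fixed $r$. For a tetrahedron $K$ with vertices numbered $0,1,2,3$, let $\lambda_0,\lambda_1,\lambda_2,\lambda_3$ be the barycentric coordinates associated with the vertices, and let $\bm{n}_i$ ($i=1,2,3$) be the unit outward normal to the face of $K$ opposite vertex $i$ (the choice of which three faces are used, i.e. of the numbering of the vertices, is arbitrary). Put $$\bm{b}_1^{\rm curl}=\lambda_2\lambda_3\lambda_0\,\bm{n}_1,\quad \bm{b}_2^{\rm curl}=\lambda_3\lambda_0\lambda_1\,\bm{n}_2,\quad \bm{b}_3^{\rm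 curl}=\lambda_0\lambda_1\lambda_2\,\bm{n}_3,$$ and $$\bm{B}_h^{\mathrm{curl}}(K)=P_{r-1}(K)\bm{b}_1^{\rm curl}+P_{r-1}(K)\bm{b}_2^{\rm curl}+P_{r-1}(K)\bm{b}_3^{\rm curl}.$$ *)

theory Defs
  imports "HOL-Analysis.Analysis"
begin

definition triangulation_of :: "(real^3) set \<Rightarrow> (real^3) set set \<Rightarrow> bool" where
  "triangulation_of \<Omega> \<T> \<longleftrightarrow>
     triangulation \<T> \<and> (\<forall>K\<in>\<T>. 3 simplex K) \<and> \<Union>\<T> = closure \<Omega>"

definition inball_diameter :: "(real^3) set \<Rightarrow> real" where
  "inball_diameter K = (SUP (x, \<rho>)\<in>{(x, \<rho>). 0 \<le> \<rho> \<and> cball x \<rho> \<subseteq> K}. 2 * \<rho>)"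

definition shape_regular :: "real \<Rightarrow> (real^3) set set \<Rightarrow> bool" where
  "shape_regular \<sigma> \<T> \<longleftrightarrow> (\<forall>K\<in>\<T>. diameter K \<le> \<sigma> * inball_diameter K)"

text \<open>Only the values \<open>a 0, \<dots>, a 3\<close> of a vertex numbering \<open>a\<close> matter.\<close>

definition tetrahedron_vertices :: "(nat \<Rightarrow> real^3) \<Rightarrow> (real^3) set \<Rightarrow> bool" where
  "tetrahedron_vertices a K \<longleftrightarrow>
     inj_on a {..3} \<and> \<not> affine_dependent (a ` {..3}) \<and> K = convex hull (a ` {..3})"

definition barycentric :: "(nat \<Rightarrow> real^3) \<Rightarrow> nat \<Rightarrow> real^3 \<Rightarrow> real" where
  "barycentric a i x =
     (THE t. \<exists>l. (\<Sum>j\<le>3. l j) = 1 \<and> (\<Sum>j\<le>3. l j *\<^sub>R a j) = x \<and> t = l i)"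

definition opposite_face :: "(nat \<Rightarrow> real^3) \<Rightarrow> nat \<Rightarrow> (real^3) set" where
  "opposite_face a i = convex hull (a ` ({..3} - {i}))"

definition outward_normal :: "(nat \<Rightarrow> real^3) \<Rightarrow> nat \<Rightarrow> real^3" where
  "outward_normal a i =
     (THE n. norm n = 1
        \<and> (\<forall>x\<in>opposite_face a i. \<forall>y\<in>opposite_face a i. n \<bullet> (y - x) = 0)
        \<and> (\<forall>x\<in>opposite_face a i. \<forall>y\<in>convex hull (a ` {..3}). n \<bullet> (y - x) \<le> 0))"

text \<open>Functions on \<open>K\<close> are represented by functions on the whole space that vanish outside \<open>K\<close>,
  so that a function on \<open>K\<close> is zero iff it equals \<open>\<lambda>_. 0\<close>.\<close>

definition poly_space :: "nat \<Rightarrow> (real^3) set \<Rightarrow> (real^3 \<Rightarrow> real) set" where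
  "poly_space m K =
     {p. \<exists>c :: (3 \<Rightarrow> nat) \<Rightarrow> real. p = (\<lambda>x. if x \<in> K
           then \<Sum>\<alpha> | (\<Sum>k\<in>UNIV. \<alpha> k) \<le> m. c \<alpha> * (\<Prod>k\<in>UNIV. (x $ k) ^ \<alpha> k) else 0)}"

lemma finite_multi_indices: "finite {\<alpha> :: 3 \<Rightarrow> nat. (\<Sum>k\<in>UNIV. \<alpha> k) \<le> m}"
proof (rule finite_subset)
  show "{\<alpha> :: 3 \<Rightarrow> nat. (\<Sum>k\<in>UNIV. \<alpha> k) \<le> m} \<subseteq> UNIV \<rightarrow>\<^sub>E {..m}"
    by (auto simp: sum_3) (metis UNIV_3 UNIV_I add_leE exhaust_3)
qed (simp add: finite_PiE)

definition D_space :: "nat \<Rightarrow> (real^3) set \<Rightarrow> (real^3 \<Rightarrow> real^3) set" where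
  "D_space r K = {q. \<forall>k. (\<lambda>x. q x $ k) \<in> poly_space (r - 1) K}"

definition curl_bubble :: "(nat \<Rightarrow> real^3) \<Rightarrow> nat \<Rightarrow> real^3 \<Rightarrow> real^3" where
  "curl_bubble a i x = (\<Prod>j\<in>{..3} - {i}. barycentric a j x) *\<^sub>R outward_normal a i"

definition B_curl_space ::
  "nat \<Rightarrow> (nat \<Rightarrow> real^3) \<Rightarrow> (real^3) set \<Rightarrow> (real^3 \<Rightarrow> real^3) set" where
  "B_curl_space r a K =
     {v. \<exists>p1\<in>poly_space (r - 1) K. \<exists>p2\<in>poly_space (r - 1) K. \<exists>p3\<in>poly_space (r - 1) K.
        v = (\<lambda>x. p1 x *\<^sub>R curl_bubble a 1 x + p2 x *\<^sub>R curl_bubble a 2 x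
                  + p3 x *\<^sub>R curl_bubble a 3 x)}"

definition L2_inner :: "(real^3) set \<Rightarrow> (real^3 \<Rightarrow> real^3) \<Rightarrow> (real^3 \<Rightarrow> real^3) \<Rightarrow> real" where
  "L2_inner K v q = (LINT x:K|lborel. v x \<bullet> q x)"

definition L2_norm :: "(real^3) set \<Rightarrow> (real^3 \<Rightarrow> real^3) \<Rightarrow> real" where
  "L2_norm K v = sqrt (L2_inner K v v)"

end

theory Submission
  imports Defs
begin

text \<open>Given a polynomial field \<open>q\<close>, test it with \<open>v = \<Sum>\<^sub>i (n\<^sub>i \<bullet> q) b\<^sub>i\<close>, where \<open>b\<^sub>i = w\<^sub>i n\<^sub>i\<close> is
  the bubble of face \<open>i\<close> and \<open>w\<^sub>i\<close> is the product of the barycentric coordinates other than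
  \<open>\<lambda>\<^sub>i\<close>. The components \<open>n\<^sub>i \<bullet> q\<close> have the admissible degree, and
  \<open>v \<bullet> q = \<Sum>\<^sub>i w\<^sub>i (n\<^sub>i \<bullet> q)\<^sup>2\<close>. Since \<open>0 \<le> w\<^sub>i \<le> 1\<close> on \<open>K\<close>, the norm of \<open>v\<close> is at most \<open>3\<close> times
  that of \<open>q\<close>, and two facts bound \<open>(v, q)\<close> below by a multiple of the squared norm of \<open>q\<close>.

  The first (\<open>poly_norm_le_weighted\<close>) is that the weight \<open>w\<^sub>i\<close> costs only a constant depending on
  the degree \<open>m\<close> of the polynomial. Instead of a compactness argument on a reference tetrahedron,
  the proof extrapolates: on the ray from the centroid \<open>b\<close> through \<open>x\<close>, the value of a polynomial
  at \<open>x\<close> is a fixed linear combination of its values at \<open>m + 1\<close> points \<open>b + t\<^sub>k (x - b)\<close> with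
  \<open>0 < t\<^sub>k < 1\<close>, because its finite difference of order \<open>m + 1\<close> vanishes. All barycentric
  coordinates, hence \<open>w\<^sub>i\<close>, are bounded below at these points, and the change of variables
  \<open>x \<mapsto> b + t\<^sub>k (x - b)\<close> leads back to the weighted integral over \<open>K\<close>
  (\<open>integral_homothety_le\<close>). No affine transformation to another element is involved, so the
  constant is explicit and the same for all tetrahedra.

  The second (\<open>norm_sq_le_normal_components\<close>) is that shape regularity bounds a vector by its
  components along three of the four face normals. The gradients \<open>g\<^sub>i\<close> of the barycentric
  coordinates are dual to the edges at vertex \<open>0\<close>, so \<open>z = \<Sum>\<^sub>i (g\<^sub>i \<bullet> z) (a\<^sub>i - a\<^sub>0)\<close>, and
  \<open>n\<^sub>i = - g\<^sub>i / |g\<^sub>i|\<close> (\<open>outward_normal_eq\<close>). The edges are no longer than the diameter, and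
  \<open>2 \<rho> |g\<^sub>i| \<le> 1\<close> if \<open>K\<close> contains a ball of radius \<open>\<rho>\<close>. So only the ratio of diameter and
  inball diameter enters.\<close>

section \<open>Extrapolation of polynomials\<close>

text \<open>Up to sign the sum is the \<open>n\<close>-th finite difference of \<open>p\<close> at \<open>0\<close>, and each
  difference step \<open>p(x) - p(x + 1)\<close> cancels the leading term. The zero polynomial is listed
  separately because its degree is \<open>0\<close>, so that \<open>n = 0\<close> is a usable start of the induction.\<close>

lemma alternating_binomial_sum_poly_eq_0:
  fixes p :: "real poly"
  assumes "p = 0 \<or> degree p < n"
  shows "(\<Sum>k\<le>n. (-1) ^ k * real (n choose k) * poly p (real k)) = 0"
  using assms
proof (induction n arbitrary: p)
  case 0
  then show ?case by simp
next
  case (Suc n)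
  define q where "q = p - p \<circ>\<^sub>p [:1, 1:]"
  have "coeff (p \<circ>\<^sub>p [:1, 1:]) (degree p) = coeff p (degree p)"
    using lead_coeff_comp[of "[:1, 1::real:]" p] by (simp add: degree_pcompose)
  then have "q = 0 \<or> degree q < degree p"
    by (intro eq_zero_or_degree_less) (auto simp: q_def degree_pcompose intro!: degree_diff_le)
  then have q: "q = 0 \<or> degree q < n"
    using Suc.prems by (auto simp: q_def)
  \<comment> \<open>Pascal's rule turns the sum for \<open>p\<close> and \<open>n + 1\<close> into the one for \<open>q\<close> and \<open>n\<close>.\<close>
  have "(\<Sum>k\<le>Suc n. (-1) ^ k * real (Suc n choose k) * poly p (real k))
      = poly p 0 + (\<Sum>k\<le>n. (-1) ^ Suc k * real (n choose Suc k) * poly p (real (Suc k)))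
        + (\<Sum>k\<le>n. (-1) ^ Suc k * real (n choose k) * poly p (real (Suc k)))"
    by (subst sum.atMost_Suc_shift) (simp add: sum.distrib[symmetric] algebra_simps)
  also have "poly p 0 + (\<Sum>k\<le>n. (-1) ^ Suc k * real (n choose Suc k) * poly p (real (Suc k)))
      = (\<Sum>k\<le>Suc n. (-1) ^ k * real (n choose k) * poly p (real k))"
    by (subst sum.atMost_Suc_shift) simp
  also have "\<dots> = (\<Sum>k\<le>n. (-1) ^ k * real (n choose k) * poly p (real k))"
    by simp
  also have "\<dots> + (\<Sum>k\<le>n. (-1) ^ Suc k * real (n choose k) * poly p (real (Suc k)))
      = (\<Sum>k\<le>n. (-1) ^ k * real (n choose k) * poly q (real k))"
    by (simp add: q_def poly_pcompose sum.distrib[symmetric] algebra_simps)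
  finally show ?case
    using Suc.IH[OF q] by simp
qed

text \<open>The points \<open>node m 0, \<dots>, node m (Suc m)\<close> are equally spaced and end at \<open>1\<close>. The value
  at the last one is extrapolated from the other \<open>m + 1\<close>, which stay away from \<open>1\<close>, so that
  homotheties with these ratios move \<open>K\<close> off its boundary, and from \<open>0\<close>, so that these
  homotheties do not collapse the volume.\<close>

definition node :: "nat \<Rightarrow> nat \<Rightarrow> real" where
  "node m k = real (Suc k) / real (m + 2)"

lemma node_bounds:
  assumes "k \<le> m"
  shows "1 / real (m + 2) \<le> node m k" "node m k \<le> 1 - 1 / real (m + 2)"
  using assms by (simp_all add: node_def divide_simps)

text \<open>A vanishing finite difference of order \<open>m + 1\<close> expresses the last value as a fixed linear
  combination of the others; then the Cauchy-Schwarz inequality applies.\<close>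

lemma poly_extrapolation_bound:
  fixes p :: "real poly"
  assumes "degree p \<le> m"
  shows "(poly p 1)\<^sup>2 \<le> (\<Sum>k\<le>m. (real (Suc m choose k))\<^sup>2) * (\<Sum>k\<le>m. (poly p (node m k))\<^sup>2)"
proof -
  define u where "u = p \<circ>\<^sub>p [:1 / real (m + 2), 1 / real (m + 2):]"
  have u: "poly u (real k) = poly p (node m k)" for k
    by (simp add: u_def poly_pcompose node_def field_simps)
  have u1: "poly u (real (Suc m)) = poly p 1"
    by (simp add: u_def poly_pcompose field_simps)
  have "degree u < Suc m"
    using assms by (simp add: u_def degree_pcompose)
  then have "(\<Sum>k\<le>Suc m. (-1) ^ k * real (Suc m choose k) * poly u (real k)) = 0"
    by (intro alternating_binomial_sum_poly_eq_0) simp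
  then have "(\<Sum>k\<le>m. ((-1) ^ k * real (Suc m choose k)) * poly p (node m k))
      = - ((-1) ^ Suc m * poly p 1)"
    unfolding sum.atMost_Suc u1 by (simp add: u del: of_nat_Suc binomial_Suc_Suc)
  then have "(poly p 1)\<^sup>2
      = (\<Sum>k\<le>m. ((-1) ^ k * real (Suc m choose k)) * poly p (node m k))\<^sup>2"
    by (simp add: power_mult_distrib flip: power_mult)
  also have "\<dots> \<le> (\<Sum>k\<le>m. ((-1) ^ k * real (Suc m choose k))\<^sup>2)
                   * (\<Sum>k\<le>m. (poly p (node m k))\<^sup>2)"
    by (rule Cauchy_Schwarz_ineq_sum)
  finally show ?thesis
    by (simp add: power_mult_distrib flip: power_mult)
qed

section \<open>Polynomials on a set\<close>

text \<open>What the estimates use of a polynomial on \<open>K\<close>: it extends continuously to the whole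
  space, with restrictions to lines that are univariate polynomials of no larger degree.\<close>

lemma poly_space_extension:
  assumes "p \<in> poly_space m K"
  obtains P where "\<And>x. p x = (if x \<in> K then P x else 0)" "continuous_on UNIV P"
    "\<And>b d. \<exists>u :: real poly. degree u \<le> m \<and> (\<forall>t. poly u t = P (b + t *\<^sub>R d))"
proof -
  obtain c where c: "p = (\<lambda>x. if x \<in> K
      then \<Sum>\<alpha> | (\<Sum>k\<in>UNIV. \<alpha> k) \<le> m. c \<alpha> * (\<Prod>k\<in>UNIV. (x $ k) ^ \<alpha> k) else 0)"
    using assms unfolding poly_space_def by blast
  define P where "P x = (\<Sum>\<alpha> | (\<Sum>k\<in>UNIV. \<alpha> k) \<le> m. c \<alpha> * (\<Prod>k\<in>UNIV. (x $ k) ^ \<alpha> k))"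
    for x :: "real^3"
  show thesis
  proof
    show "p x = (if x \<in> K then P x else 0)" for x
      by (simp add: c P_def)
    show "continuous_on UNIV P"
      unfolding P_def by (intro continuous_intros)
    fix b d :: "real^3"
    define M where "M \<alpha> = (\<Prod>k\<in>UNIV. [:b $ k, d $ k:] ^ \<alpha> k)" for \<alpha> :: "3 \<Rightarrow> nat"
    define u where "u = (\<Sum>\<alpha> | (\<Sum>k\<in>UNIV. \<alpha> k) \<le> m. smult (c \<alpha>) (M \<alpha>))"
    have "degree (M \<alpha>) \<le> (\<Sum>k\<in>UNIV. \<alpha> k)" for \<alpha>
    proof -
      have "degree (M \<alpha>) \<le> (\<Sum>k\<in>UNIV. degree ([:b $ k, d $ k:] ^ \<alpha> k))"
        unfolding M_def using degree_prod_sum_le[of UNIV "\<lambda>k. [:b $ k, d $ k:] ^ \<alpha> k"]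
        by (simp add: o_def)
      also have "\<dots> \<le> (\<Sum>k\<in>UNIV. \<alpha> k)"
      proof (rule sum_mono)
        fix k
        have "degree ([:b $ k, d $ k:] ^ \<alpha> k) \<le> degree [:b $ k, d $ k:] * \<alpha> k"
          by (rule degree_power_le)
        also have "\<dots> \<le> 1 * \<alpha> k"
          by (intro mult_right_mono) auto
        finally show "degree ([:b $ k, d $ k:] ^ \<alpha> k) \<le> \<alpha> k" by simp
      qed
      finally show ?thesis .
    qed
    then have "degree u \<le> m"
      unfolding u_def
      by (intro degree_sum_le finite_multi_indices) (auto intro: order_trans[OF degree_smult_le] order_trans)
    moreover have "poly u t = P (b + t *\<^sub>R d)" for t
      by (simp add: u_def M_def P_def poly_sum poly_prod)
    ultimately show "\<exists>u :: real poly. degree u \<le> m \<and> (\<forall>t. poly u t = P (b + t *\<^sub>R d))"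
      by blast
  qed
qed

lemma poly_space_add:
  assumes "p \<in> poly_space m K" "q \<in> poly_space m K"
  shows "(\<lambda>x. p x + q x) \<in> poly_space m K"
proof -
  from assms obtain c d where "p = (\<lambda>x. if x \<in> K
      then \<Sum>\<alpha> | (\<Sum>k\<in>UNIV. \<alpha> k) \<le> m. c \<alpha> * (\<Prod>k\<in>UNIV. (x $ k) ^ \<alpha> k) else 0)"
    "q = (\<lambda>x. if x \<in> K
      then \<Sum>\<alpha> | (\<Sum>k\<in>UNIV. \<alpha> k) \<le> m. d \<alpha> * (\<Prod>k\<in>UNIV. (x $ k) ^ \<alpha> k) else 0)"
    unfolding poly_space_def by blast
  then have "(\<lambda>x. p x + q x) = (\<lambda>x. if x \<in> K
      then \<Sum>\<alpha> | (\<Sum>k\<in>UNIV. \<alpha> k) \<le> m. (c \<alpha> + d \<alpha>) * (\<Prod>k\<in>UNIV. (x $ k) ^ \<alpha> k) else 0)"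
    by (auto simp: sum.distrib algebra_simps)
  then show ?thesis
    unfolding poly_space_def by (intro CollectI exI)
qed

lemma poly_space_scale:
  assumes "p \<in> poly_space m K"
  shows "(\<lambda>x. s * p x) \<in> poly_space m K"
proof -
  from assms obtain c where "p = (\<lambda>x. if x \<in> K
      then \<Sum>\<alpha> | (\<Sum>k\<in>UNIV. \<alpha> k) \<le> m. c \<alpha> * (\<Prod>k\<in>UNIV. (x $ k) ^ \<alpha> k) else 0)"
    unfolding poly_space_def by blast
  then have "(\<lambda>x. s * p x) = (\<lambda>x. if x \<in> K
      then \<Sum>\<alpha> | (\<Sum>k\<in>UNIV. \<alpha> k) \<le> m. (s * c \<alpha>) * (\<Prod>k\<in>UNIV. (x $ k) ^ \<alpha> k) else 0)"
    by (auto simp: sum_distrib_left algebra_simps)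
  then show ?thesis
    unfolding poly_space_def by (intro CollectI exI)
qed

lemma D_space_inner_const:
  assumes "q \<in> D_space r K"
  shows "(\<lambda>x. n \<bullet> q x) \<in> poly_space (r - 1) K"
proof -
  have "(\<lambda>x. q x $ k) \<in> poly_space (r - 1) K" for k
    using assms by (simp add: D_space_def)
  then show ?thesis
    unfolding inner_vec_def sum_3 inner_real_def
    by (intro poly_space_add poly_space_scale)
qed

lemma poly_space_continuous_on:
  assumes "p \<in> poly_space m K"
  shows "continuous_on K p"
proof -
  obtain P where "\<And>x. p x = (if x \<in> K then P x else 0)" "continuous_on UNIV P"
    using poly_space_extension[OF assms] by metis
  then show ?thesis
    by (metis (no_types, lifting) UNIV_I continuous_on_cong continuous_on_subset subsetI)
qed

lemma poly_space_eq_0_outside: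
  "p \<in> poly_space m K \<Longrightarrow> x \<notin> K \<Longrightarrow> p x = 0"
  by (auto simp: poly_space_def)

lemma D_space_continuous_on:
  assumes "q \<in> D_space r K"
  shows "continuous_on K q"
proof -
  have "continuous_on K (\<lambda>x. \<chi> k. q x $ k)"
    using assms by (intro continuous_on_vec_lambda poly_space_continuous_on[of _ "r - 1"])
      (simp add: D_space_def)
  then show ?thesis by simp
qed

lemma D_space_eq_0_outside:
  assumes "q \<in> D_space r K" "x \<notin> K"
  shows "q x = 0"
proof -
  have "q x $ k = 0" for k
    using assms poly_space_eq_0_outside[of "\<lambda>x. q x $ k" "r - 1" K x] by (simp add: D_space_def)
  then show ?thesis by (simp add: vec_eq_iff)
qed

section \<open>Integrals over a compact set\<close>

text \<open>The interior points where \<open>f\<close> is nonzero form an open null set, which must be empty; the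
  values on the boundary follow by continuity. This makes the norms in the inf-sup quotient
  positive, so that the quotient is not a division by zero.\<close>

lemma L2_norm_eq_0_imp_eq_0:
  fixes f :: "real^3 \<Rightarrow> real^3"
  assumes K: "compact K" "closure (interior K) = K" and f: "continuous_on K f"
    and outside: "\<And>x. x \<notin> K \<Longrightarrow> f x = 0" and norm: "L2_norm K f = 0"
  shows "f = (\<lambda>_. 0)"
proof -
  define g where "g x = f x \<bullet> f x" for x
  have g: "continuous_on K g"
    unfolding g_def by (intro continuous_intros f)
  have "integrable lborel (\<lambda>x. indicator K x *\<^sub>R g x)"
    by (intro borel_integrable_compact K g)
  moreover have "(LINT x|lborel. indicator K x *\<^sub>R g x) = 0"
    using norm by (simp add: L2_norm_def L2_inner_def set_lebesgue_integral_def g_def)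
  ultimately have "AE x in lborel. indicator K x *\<^sub>R g x = 0"
    by (subst (asm) integral_nonneg_eq_0_iff_AE) (auto simp: g_def)
  then have ae: "AE x in lborel. x \<notin> {x \<in> interior K. g x \<noteq> 0}"
    by eventually_elim (use interior_subset[of K] in \<open>auto simp: indicator_def split: if_splits\<close>)
  have op: "open {x \<in> interior K. g x \<noteq> 0}"
  proof -
    have "open (interior K \<inter> g -` (- {0}))"
      by (intro continuous_open_preimage continuous_on_subset[OF g] interior_subset) auto
    moreover have "interior K \<inter> g -` (- {0}) = {x \<in> interior K. g x \<noteq> 0}"
      by auto
    ultimately show ?thesis by simp
  qed
  then have "{x \<in> interior K. g x \<noteq> 0} \<in> null_sets lborel"
    using ae by (subst AE_iff_null_sets) auto
  then have "negligible {x \<in> interior K. g x \<noteq> 0}"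
    by (simp add: negligible_iff_null_sets null_sets_completionI)
  then have "{x \<in> interior K. g x \<noteq> 0} = {}"
    using op open_not_negligible by blast
  then have "g x = 0" if "x \<in> interior K" for x
    using that by blast
  then have "g x = 0" if "x \<in> K" for x
    using continuous_constant_on_closure[of "interior K" g 0 x] g K that by simp
  then show ?thesis
    using outside by (auto simp: g_def fun_eq_iff)
qed

text \<open>Substituting \<open>y = (1 - t) b + t x\<close> turns the left side into the integral of \<open>f\<close> over the
  image of \<open>K\<close>, which is a part of \<open>K\<close> by convexity.\<close>

lemma integral_homothety_le:
  fixes f :: "real^3 \<Rightarrow> real"
  assumes K: "compact K" "convex K" "b \<in> K" and f: "continuous_on UNIV f" "\<And>x. x \<in> K \<Longrightarrow> 0 \<le> f x"
    and t: "0 < t" "t \<le> 1"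
  shows "t ^ 3 * (LINT x:K|lborel. f ((1 - t) *\<^sub>R b + t *\<^sub>R x)) \<le> (LINT x:K|lborel. f x)"
proof -
  define F where "F x = (1 - t) *\<^sub>R b + t *\<^sub>R x" for x :: "real^3"
  have FK: "F x \<in> K" if "x \<in> K" for x
    using K t that by (simp add: F_def convex_alt)
  have contF: "continuous_on UNIV F"
    unfolding F_def by (intro continuous_intros)
  have Kb[measurable]: "K \<in> sets borel"
    using K by (simp add: borel_compact)
  have fm[measurable]: "f \<in> borel_measurable borel"
    using f by (simp add: borel_measurable_continuous_onI)
  have Fm[measurable]: "F \<in> borel_measurable borel"
    using contF by (simp add: borel_measurable_continuous_onI)
  define g where "g x = indicator K x *\<^sub>R f x" for x
  have gm[measurable]: "g \<in> borel_measurable borel"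
    unfolding g_def by measurable
  have gint: "integrable lborel g"
    unfolding g_def using K f by (intro borel_integrable_compact) (auto intro: continuous_on_subset)
  have aff: "(lborel :: (real^3) measure) = density (distr lborel borel F) (\<lambda>_. ennreal (t ^ 3))"
    using lborel_affine[of t "(1 - t) *\<^sub>R b"] t by (simp add: F_def[abs_def] ennreal_power)
  \<comment> \<open>Extending \<open>f\<close> by zero turns the inclusion of the image of \<open>K\<close> in \<open>K\<close> into a pointwise inequality.\<close>
  have eq: "(LINT x|lborel. g x) = (LINT x|lborel. t ^ 3 * g (F x))"
    using t by (subst aff) (simp add: integral_density integral_distr)
  have "integrable (density (distr lborel borel F) (\<lambda>_. ennreal (t ^ 3))) g"
    using gint aff by simp
  then have gF: "integrable lborel (\<lambda>x. t ^ 3 * g (F x))"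
    using t by (subst (asm) integrable_density) (auto simp: integrable_distr_eq)
  have "t ^ 3 * (LINT x:K|lborel. f (F x)) = (LINT x|lborel. indicator K x *\<^sub>R (t ^ 3 * f (F x)))"
    by (simp add: set_lebesgue_integral_def flip: integral_mult_right_zero) (simp add: mult_ac)
  also have "\<dots> \<le> (LINT x|lborel. t ^ 3 * g (F x))"
  proof (intro integral_mono gF borel_integrable_compact K)
    show "continuous_on K (\<lambda>x. t ^ 3 * f (F x))"
      by (intro continuous_intros continuous_on_compose2[OF f(1)] continuous_on_subset[OF contF]) auto
    show "indicat_real K x *\<^sub>R (t ^ 3 * f (F x)) \<le> t ^ 3 * g (F x)" for x
      using FK[of x] f(2) t by (auto simp: g_def indicator_def)
  qed
  finally show ?thesis
    unfolding eq[symmetric] by (simp add: g_def[abs_def] F_def set_lebesgue_integral_def)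
qed

section \<open>Barycentric coordinates\<close>

locale tetrahedron =
  fixes a :: "nat \<Rightarrow> real^3" and K :: "(real^3) set"
  assumes vertices: "tetrahedron_vertices a K"
begin

lemma inj: "inj_on a {..3}" and indep: "\<not> affine_dependent (a ` {..3})"
  and K_eq: "K = convex hull (a ` {..3})"
  using vertices by (auto simp: tetrahedron_vertices_def)

lemma barycentric_exists:
  obtains l where "(\<Sum>j\<le>3. l j) = 1" "(\<Sum>j\<le>3. l j *\<^sub>R a j) = x"
proof -
  have "affine hull (a ` {..3}) = UNIV"
    by (intro affine_independent_span_eq indep) (simp add: card_image inj)
  then have "x \<in> {y. \<exists>u. sum u (a ` {..3}) = 1 \<and> (\<Sum>v\<in>a ` {..3}. u v *\<^sub>R v) = y}"
    by (subst affine_hull_finite[symmetric]) auto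
  then obtain u where "sum u (a ` {..3}) = 1" "(\<Sum>v\<in>a ` {..3}. u v *\<^sub>R v) = x"
    by blast
  then show thesis
    by (intro that[of "\<lambda>j. u (a j)"]) (simp_all add: sum.reindex inj)
qed

lemma barycentric_unique:
  assumes "(\<Sum>j\<le>3. l j) = (1::real)" "(\<Sum>j\<le>3. l j *\<^sub>R a j) = x"
    "(\<Sum>j\<le>3. l' j) = 1" "(\<Sum>j\<le>3. l' j *\<^sub>R a j) = x" "i \<le> 3"
  shows "l i = l' i"
proof (rule ccontr)
  assume neq: "l i \<noteq> l' i"
  define u where "u v = l (the_inv_into {..3} a v) - l' (the_inv_into {..3} a v)" for v
  have u: "u (a j) = l j - l' j" if "j \<le> 3" for j
    using that by (simp add: u_def the_inv_into_f_f inj)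
  have "sum u (a ` {..3}) = (\<Sum>j\<le>3. l j - l' j)"
    by (simp add: sum.reindex inj u)
  moreover have "(\<Sum>v\<in>a ` {..3}. u v *\<^sub>R v) = (\<Sum>j\<le>3. (l j - l' j) *\<^sub>R a j)"
    by (simp add: sum.reindex inj u)
  ultimately have "affine_dependent (a ` {..3})"
    using assms neq u
    by (subst affine_dependent_explicit_finite)
      (auto simp: sum_subtractf scaleR_diff_left intro!: exI[of _ u] bexI[of _ i])
  with indep show False by simp
qed

lemma barycentric_eqI:
  assumes "(\<Sum>j\<le>3. l j) = 1" "(\<Sum>j\<le>3. l j *\<^sub>R a j) = x" "i \<le> 3"
  shows "barycentric a i x = l i"
  unfolding barycentric_def
proof (rule the_equality)
  show "\<exists>m. (\<Sum>j\<le>3. m j) = 1 \<and> (\<Sum>j\<le>3. m j *\<^sub>R a j) = x \<and> l i = m i"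
    using assms by blast
qed (use assms barycentric_unique in blast)

lemma barycentric_sum: "(\<Sum>j\<le>3. barycentric a j x) = 1"
  and barycentric_combination: "(\<Sum>j\<le>3. barycentric a j x *\<^sub>R a j) = x"
proof -
  obtain l where l: "(\<Sum>j\<le>3. l j) = 1" "(\<Sum>j\<le>3. l j *\<^sub>R a j) = x"
    by (rule barycentric_exists)
  then have "barycentric a j x = l j" if "j \<le> 3" for j
    using that by (intro barycentric_eqI)
  with l show "(\<Sum>j\<le>3. barycentric a j x) = 1" "(\<Sum>j\<le>3. barycentric a j x *\<^sub>R a j) = x"
    by auto
qed

text \<open>Uniqueness makes the coordinates affine. Three weighted points, instead of two, also yield
  additivity and homogeneity of \<open>barycentric a i x - barycentric a i 0\<close> when the third is \<open>0\<close>.\<close>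

lemma barycentric_affine:
  assumes "i \<le> 3"
  shows "barycentric a i (s *\<^sub>R x + t *\<^sub>R y + (1 - s - t) *\<^sub>R z)
    = s * barycentric a i x + t * barycentric a i y + (1 - s - t) * barycentric a i z"
proof (rule barycentric_eqI[where l = "\<lambda>i. s * barycentric a i x + t * barycentric a i y
      + (1 - s - t) * barycentric a i z", OF _ _ assms])
  show "(\<Sum>j\<le>3. s * barycentric a j x + t * barycentric a j y + (1 - s - t) * barycentric a j z) = 1"
    unfolding sum.distrib sum_distrib_left[symmetric] barycentric_sum by simp
  show "(\<Sum>j\<le>3. (s * barycentric a j x + t * barycentric a j y + (1 - s - t) * barycentric a j z) *\<^sub>R a j)
      = s *\<^sub>R x + t *\<^sub>R y + (1 - s - t) *\<^sub>R z"
    unfolding scaleR_add_left sum.distrib scaleR_scaleR[symmetric] scaleR_sum_right[symmetric]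
      barycentric_combination by simp
qed

lemma barycentric_segment:
  assumes "i \<le> 3"
  shows "barycentric a i ((1 - t) *\<^sub>R x + t *\<^sub>R y) = (1 - t) * barycentric a i x + t * barycentric a i y"
  using barycentric_affine[OF assms, of "1 - t" x t y 0] by simp

lemma barycentric_vertex:
  assumes "i \<le> 3" "j \<le> 3"
  shows "barycentric a i (a j) = (if i = j then 1 else 0)"
proof (rule barycentric_eqI[where l = "\<lambda>i. if i = j then 1 else 0", OF _ _ assms(1)])
  show "(\<Sum>k\<le>3. (if k = j then 1 else (0::real)) *\<^sub>R a k) = a j"
    using assms by (subst sum.remove[of _ j]) (auto intro!: sum.neutral)
qed (use assms in \<open>simp add: sum.delta\<close>)

lemma mem_K_I:
  assumes "\<And>j. j \<le> 3 \<Longrightarrow> 0 \<le> barycentric a j x"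
  shows "x \<in> K"
proof -
  have "(\<Sum>j\<le>3. barycentric a j x *\<^sub>R a j) \<in> K"
    unfolding K_eq using assms
    by (intro convex_sum) (auto simp: barycentric_sum intro: hull_inc)
  then show ?thesis by (simp add: barycentric_combination)
qed

lemma barycentric_nonneg:
  assumes "x \<in> K" "i \<le> 3"
  shows "0 \<le> barycentric a i x"
proof -
  have "convex {x. 0 \<le> barycentric a i x}"
    using assms(2) by (auto simp: convex_alt barycentric_segment)
  then have "K \<subseteq> {x. 0 \<le> barycentric a i x}"
    unfolding K_eq using assms(2) by (intro hull_minimal) (auto simp: barycentric_vertex)
  with assms(1) show ?thesis by auto
qed

lemma barycentric_le_1:
  assumes "x \<in> K" "i \<le> 3"
  shows "barycentric a i x \<le> 1"
  using member_le_sum[of i "{..3}" "\<lambda>j. barycentric a j x"] barycentric_nonneg[OF assms(1)] assms(2)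
  by (simp add: barycentric_sum)

lemma barycentric_opposite_face:
  assumes "x \<in> opposite_face a i" "i \<le> 3"
  shows "barycentric a i x = 0"
proof -
  have "convex {x. barycentric a i x = 0}"
    using assms(2) by (auto simp: convex_alt barycentric_segment)
  then have "opposite_face a i \<subseteq> {x. barycentric a i x = 0}"
    unfolding opposite_face_def using assms(2) by (intro hull_minimal) (auto simp: barycentric_vertex)
  with assms(1) show ?thesis by auto
qed

text \<open>The constant gradient of a barycentric coordinate: the vector that represents its linear
  part.\<close>

definition grad :: "nat \<Rightarrow> real^3" where
  "grad i = adjoint (\<lambda>x. barycentric a i x - barycentric a i 0) (1::real)"

lemma barycentric_diff:
  assumes "i \<le> 3"
  shows "barycentric a i y - barycentric a i x = grad i \<bullet> (y - x)"
proof -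
  have "linear (\<lambda>x. barycentric a i x - barycentric a i 0)"
  proof (rule linearI)
    fix x y :: "real^3" and s :: real
    show "barycentric a i (x + y) - barycentric a i 0
        = barycentric a i x - barycentric a i 0 + (barycentric a i y - barycentric a i 0)"
      using barycentric_affine[OF assms, of 1 x 1 y 0] by simp
    show "barycentric a i (s *\<^sub>R x) - barycentric a i 0 = s *\<^sub>R (barycentric a i x - barycentric a i 0)"
      using barycentric_affine[OF assms, of s x 0 0 0] by (simp add: algebra_simps)
  qed
  from adjoint_works[OF this, of _ 1]
  have "grad i \<bullet> x = barycentric a i x - barycentric a i 0" for x
    by (simp add: grad_def inner_commute)
  then show ?thesis by (simp add: inner_diff_right)
qed

lemma continuous_on_barycentric:
  assumes "i \<le> 3"
  shows "continuous_on S (barycentric a i)"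
proof -
  have "barycentric a i = (\<lambda>x. barycentric a i 0 + grad i \<bullet> (x - 0))"
    by (rule ext) (simp only: barycentric_diff[OF assms, symmetric])
  moreover have "continuous_on S (\<lambda>x. barycentric a i 0 + grad i \<bullet> (x - 0))"
    by (intro continuous_intros)
  ultimately show ?thesis by metis
qed

lemma grad_nonzero: "i \<le> 3 \<Longrightarrow> grad i \<noteq> 0"
  using barycentric_diff[of i "a i" "a (if i = 0 then 1 else 0)"]
  by (auto simp: barycentric_vertex split: if_splits)

text \<open>The base point \<open>b\<close> is free because the gradients sum to zero.\<close>

lemma grad_expansion_base: "z = (\<Sum>j\<le>3. (grad j \<bullet> z) *\<^sub>R (a j - b))"
proof -
  have g: "grad j \<bullet> z = barycentric a j z - barycentric a j 0" if "j \<le> 3" for j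
    using barycentric_diff[OF that, of z 0] by simp
  have s: "(\<Sum>j\<le>3. grad j \<bullet> z) = 0"
    by (simp add: g sum_subtractf barycentric_sum)
  have "z = (\<Sum>j\<le>3. (grad j \<bullet> z) *\<^sub>R a j)"
    by (simp add: g sum_subtractf scaleR_diff_left barycentric_combination)
  also have "\<dots> = (\<Sum>j\<le>3. (grad j \<bullet> z) *\<^sub>R (a j - b))"
    by (simp add: scaleR_diff_right sum_subtractf s flip: scaleR_sum_left)
  finally show ?thesis .
qed

text \<open>The gradients are the basis dual to the edges at vertex \<open>0\<close>.\<close>

lemma grad_expansion: "z = (\<Sum>j=1..3. (grad j \<bullet> z) *\<^sub>R (a j - a 0))"
proof -
  have "z = (\<Sum>j\<le>3. (grad j \<bullet> z) *\<^sub>R (a j - a 0))"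
    by (rule grad_expansion_base)
  also have "\<dots> = (\<Sum>j=1..3. (grad j \<bullet> z) *\<^sub>R (a j - a 0))"
  proof (intro sum.mono_neutral_right ballI)
    show "(grad j \<bullet> z) *\<^sub>R (a j - a 0) = 0" if "j \<in> {..3} - {1..3}" for j
      using that by (cases j) auto
  qed auto
  finally show ?thesis .
qed

text \<open>The coordinate \<open>i\<close> vanishes on the face opposite vertex \<open>i\<close> and is nonnegative on \<open>K\<close>, so
  it decreases fastest in the outward normal direction.\<close>

lemma outward_normal_eq:
  assumes i: "i \<le> 3"
  shows "outward_normal a i = - (inverse (norm (grad i)) *\<^sub>R grad i)"
  unfolding outward_normal_def K_eq[symmetric]
proof (rule the_equality, intro conjI ballI)
  let ?n = "- (inverse (norm (grad i)) *\<^sub>R grad i)"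
  show "norm ?n = 1"
    using grad_nonzero[OF i] by simp
  have n: "?n \<bullet> (y - x) = inverse (norm (grad i)) * (barycentric a i x - barycentric a i y)" for x y
    by (simp add: barycentric_diff[OF i] inner_diff_right algebra_simps)
  show "?n \<bullet> (y - x) = 0" if "x \<in> opposite_face a i" "y \<in> opposite_face a i" for x y
    using that i unfolding n by (simp add: barycentric_opposite_face)
  show "?n \<bullet> (y - x) \<le> 0" if "x \<in> opposite_face a i" "y \<in> K" for x y
    using that i unfolding n
    by (simp add: barycentric_opposite_face barycentric_nonneg mult_nonneg_nonneg)
next
  fix n
  assume n: "norm n = 1 \<and>
    (\<forall>x\<in>opposite_face a i. \<forall>y\<in>opposite_face a i. n \<bullet> (y - x) = 0) \<and>
    (\<forall>x\<in>opposite_face a i. \<forall>y\<in>K. n \<bullet> (y - x) \<le> 0)"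
  define b where "b = (if i = 0 then a 1 else a 0)"
  have face: "a j \<in> opposite_face a i" if "j \<le> 3" "j \<noteq> i" for j
    using that by (auto simp: opposite_face_def intro: hull_inc)
  have b: "b \<in> opposite_face a i"
    using face[of 0] face[of 1] by (auto simp: b_def)
  define s where "s = n \<bullet> (a i - b)"
  have s: "s \<le> 0"
  proof -
    have "a i \<in> K"
      using i by (auto simp: K_eq intro: hull_inc)
    with n b show ?thesis by (simp add: s_def)
  qed
  \<comment> \<open>\<open>n\<close> annihilates the directions of the face, so it is a multiple of the gradient.\<close>
  have "n \<bullet> z = (s *\<^sub>R grad i) \<bullet> z" for z
  proof -
    have "n \<bullet> z = n \<bullet> (\<Sum>j\<le>3. (grad j \<bullet> z) *\<^sub>R (a j - b))"
      by (subst grad_expansion_base[of z b]) (rule refl)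
    also have "\<dots> = (\<Sum>j\<le>3. (grad j \<bullet> z) * (n \<bullet> (a j - b)))"
      by (simp add: inner_sum_right)
    also have "\<dots> = (\<Sum>j\<le>3. if j = i then (grad i \<bullet> z) * s else 0)"
      using n b face by (intro sum.cong) (auto simp: s_def)
    also have "\<dots> = (s *\<^sub>R grad i) \<bullet> z"
      using i by simp
    finally show ?thesis .
  qed
  then have ns: "n = s *\<^sub>R grad i"
    using vector_eq_rdot[of n "s *\<^sub>R grad i"] by blast
  with n have "\<bar>s\<bar> * norm (grad i) = 1" by simp
  with s grad_nonzero[OF i] have "s = - inverse (norm (grad i))"
    by (simp add: field_simps)
  with ns show "n = - (inverse (norm (grad i)) *\<^sub>R grad i)" by simp
qed

lemma norm_outward_normal: "i \<le> 3 \<Longrightarrow> norm (outward_normal a i) = 1"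
  using grad_nonzero[of i] by (simp add: outward_normal_eq)

end

section \<open>Weighted norms on a tetrahedron\<close>

lemma set_integrable_compact:
  fixes f :: "real^3 \<Rightarrow> real"
  assumes "compact K" "continuous_on K f"
  shows "set_integrable lborel K f"
  unfolding set_integrable_def using assms by (rule borel_integrable_compact)

lemma set_integral_ge_0:
  fixes f :: "real^3 \<Rightarrow> real"
  assumes "\<And>x. x \<in> K \<Longrightarrow> 0 \<le> f x"
  shows "0 \<le> (LINT x:K|lborel. f x)"
  unfolding set_lebesgue_integral_def using assms
  by (intro Bochner_Integration.integral_nonneg) (auto simp: indicator_def)

lemma set_integral_sum_compact:
  fixes f :: "'i \<Rightarrow> real^3 \<Rightarrow> real"
  assumes "compact K" "\<And>i. i \<in> I \<Longrightarrow> continuous_on K (f i)"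
  shows "(LINT x:K|lborel. (\<Sum>i\<in>I. f i x)) = (\<Sum>i\<in>I. LINT x:K|lborel. f i x)"
  unfolding set_lebesgue_integral_def scaleR_sum_right
  using assms by (intro Bochner_Integration.integral_sum borel_integrable_compact)

lemma L2_norm_nonneg: "0 \<le> L2_norm K f"
  and L2_norm_sq: "(L2_norm K f)\<^sup>2 = L2_inner K f f"
  by (simp_all add: L2_norm_def L2_inner_def set_integral_ge_0)

text \<open>The factors are the constant of the extrapolation bound, the number of nodes, the inverse of
  the lower bound for the weight on the shrunken tetrahedra, and the inverse of their least volume
  ratio.\<close>

definition weight_const :: "nat \<Rightarrow> real" where
  "weight_const m = (\<Sum>k\<le>m. (real (Suc m choose k))\<^sup>2) * real (Suc m) * (4 * real (m + 2)) ^ 3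
     * real (m + 2) ^ 3"

lemma weight_const_pos: "0 < weight_const m"
proof -
  have "0 < (\<Sum>k\<le>m. (real (Suc m choose k))\<^sup>2)"
    by (intro sum_pos2[of _ 0]) auto
  then show ?thesis by (simp add: weight_const_def)
qed

context tetrahedron
begin

lemma K_compact: "compact K" and K_convex: "convex K"
  by (simp_all add: K_eq finite_imp_compact_convex_hull)

lemma closure_interior_K: "closure (interior K) = K"
proof -
  have "interior K \<noteq> {}"
    unfolding K_eq by (subst interior_convex_hull_eq_empty) (simp_all add: card_image inj indep)
  then show ?thesis
    using convex_closure_interior[OF K_convex] K_compact by (simp add: compact_imp_closed)
qed

lemma vertex_in_K: "i \<le> 3 \<Longrightarrow> a i \<in> K"
  by (auto simp: K_eq intro: hull_inc)

lemma diameter_pos: "0 < diameter K"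
proof -
  have "a 0 \<noteq> a 1"
    using inj_onD[OF inj, of 0 1] by auto
  then have "0 < dist (a 0) (a 1)" by simp
  also have "\<dots> \<le> diameter K"
    by (intro diameter_bounded_bound) (simp_all add: vertex_in_K compact_imp_bounded K_compact)
  finally show ?thesis .
qed

definition centroid :: "real^3" where
  "centroid = (\<Sum>j\<le>3. (1 / 4) *\<^sub>R a j)"

lemma barycentric_centroid: "i \<le> 3 \<Longrightarrow> barycentric a i centroid = 1 / 4"
  by (rule barycentric_eqI[where l = "\<lambda>_. 1 / 4"]) (simp_all add: centroid_def)

lemma centroid_in_K: "centroid \<in> K"
  by (rule mem_K_I) (simp add: barycentric_centroid)

definition weight :: "nat \<Rightarrow> real^3 \<Rightarrow> real" where
  "weight i x = (\<Prod>j\<in>{..3} - {i}. barycentric a j x)"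

lemma curl_bubble_eq: "curl_bubble a i x = weight i x *\<^sub>R outward_normal a i"
  by (simp add: curl_bubble_def weight_def)

lemma continuous_on_weight: "continuous_on S (weight i)"
  unfolding weight_def[abs_def] by (intro continuous_intros continuous_on_barycentric) auto

lemma weight_nonneg: "x \<in> K \<Longrightarrow> 0 \<le> weight i x"
  unfolding weight_def by (intro prod_nonneg) (auto intro: barycentric_nonneg)

lemma weight_le_1: "x \<in> K \<Longrightarrow> weight i x \<le> 1"
  unfolding weight_def by (intro prod_le_1) (auto intro: barycentric_nonneg barycentric_le_1)

text \<open>Every coordinate of the centroid is \<open>1 / 4\<close> and its share in the combination is at least
  \<open>1 / (m + 2)\<close>, so each of the three factors of the weight is at least \<open>1 / (4 (m + 2))\<close>.\<close>

lemma weight_shrunk_ge: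
  assumes "x \<in> K" "k \<le> m" "i \<le> 3"
  shows "1 \<le> (4 * real (m + 2)) ^ 3 * weight i ((1 - node m k) *\<^sub>R centroid + node m k *\<^sub>R x)"
proof -
  let ?e = "1 / (4 * real (m + 2))" and ?y = "(1 - node m k) *\<^sub>R centroid + node m k *\<^sub>R x"
  have n: "1 / real (m + 2) \<le> 1 - node m k" "0 \<le> node m k"
    using node_bounds[OF assms(2)] by (auto simp: node_def)
  have "?e \<le> barycentric a j ?y" if "j \<le> 3" for j
  proof -
    have "0 \<le> node m k * barycentric a j x"
      using n assms(1) that by (intro mult_nonneg_nonneg barycentric_nonneg)
    moreover have "?e \<le> (1 - node m k) * (1 / 4)"
      using mult_right_mono[OF n(1), of "1 / 4"] by (simp add: mult.commute del: of_nat_add)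
    ultimately show ?thesis
      unfolding barycentric_segment[OF that] barycentric_centroid[OF that]
      by (rule add_increasing2)
  qed
  then have "(\<Prod>j\<in>{..3} - {i}. ?e) \<le> weight i ?y"
    unfolding weight_def by (intro prod_mono) auto
  then have "?e ^ 3 \<le> weight i ?y"
    using assms(3) by simp
  then show ?thesis
    by (simp add: power_divide field_simps)
qed

text \<open>The weight degenerates only at the boundary of \<open>K\<close>. A polynomial is controlled there by
  extrapolation along the rays from the centroid, from points where the weight is bounded below.
  Integrating over \<open>x\<close> and rescaling each term gives a constant that depends on the degree
  alone.\<close>

lemma poly_norm_le_weighted:
  assumes p: "p \<in> poly_space m K" and i: "i \<le> 3"
  shows "(LINT x:K|lborel. (p x)\<^sup>2) \<le> weight_const m * (LINT x:K|lborel. weight i x * (p x)\<^sup>2)"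
proof -
  obtain P where P: "\<And>x. p x = (if x \<in> K then P x else 0)" "continuous_on UNIV P"
    and line: "\<And>b d. \<exists>u :: real poly. degree u \<le> m \<and> (\<forall>t. poly u t = P (b + t *\<^sub>R d))"
    using poly_space_extension[OF p] by metis
  define f where "f x = weight i x * (P x)\<^sup>2" for x
  define F where "F k x = (1 - node m k) *\<^sub>R centroid + node m k *\<^sub>R x" for k x
  define S where "S = (\<Sum>k\<le>m. (real (Suc m choose k))\<^sup>2)"
  define E where "E = (4 * real (m + 2)) ^ 3"
  have S: "0 \<le> S" and E: "0 \<le> E"
    by (auto simp: S_def E_def intro!: sum_nonneg)
  have cf: "continuous_on UNIV f"
    unfolding f_def by (intro continuous_intros continuous_on_weight P)
  have f0: "0 \<le> f x" if "x \<in> K" for x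
    using that by (simp add: f_def weight_nonneg)
  have nd: "0 < node m k" "node m k \<le> 1" if "k \<le> m" for k
    using node_bounds[OF that] that by (auto simp: node_def divide_simps)
  have FK: "F k x \<in> K" if "x \<in> K" "k \<le> m" for k x
    unfolding F_def using nd[OF that(2)] that(1) centroid_in_K K_convex
    by (auto simp: convex_alt)
  have cfF: "continuous_on K (\<lambda>x. f (F k x))" for k
    unfolding F_def by (intro continuous_intros continuous_on_compose2[OF cf]) auto
  have pt: "(p x)\<^sup>2 \<le> S * E * (\<Sum>k\<le>m. f (F k x))" if x: "x \<in> K" for x
  proof -
    obtain u :: "real poly" where u: "degree u \<le> m"
      "\<And>t. poly u t = P (centroid + t *\<^sub>R (x - centroid))"
      using line by blast
    have uF: "poly u (node m k) = P (F k x)" for k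
      by (simp add: u F_def algebra_simps)
    have "(p x)\<^sup>2 = (poly u 1)\<^sup>2"
      using x by (simp add: P u)
    also have "\<dots> \<le> S * (\<Sum>k\<le>m. (P (F k x))\<^sup>2)"
      using poly_extrapolation_bound[OF u(1)] by (simp add: uF S_def)
    also have "\<dots> \<le> S * (\<Sum>k\<le>m. E * f (F k x))"
    proof (intro mult_left_mono sum_mono S)
      fix k assume "k \<in> {..m}"
      then have "1 * (P (F k x))\<^sup>2 \<le> (E * weight i (F k x)) * (P (F k x))\<^sup>2"
        using weight_shrunk_ge[OF x _ i, of k m] by (intro mult_right_mono) (auto simp: E_def F_def)
      then show "(P (F k x))\<^sup>2 \<le> E * f (F k x)"
        by (simp add: f_def mult_ac)
    qed
    finally show ?thesis
      by (simp add: sum_distrib_left mult_ac)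
  qed
  have hom: "(LINT x:K|lborel. f (F k x)) \<le> real (m + 2) ^ 3 * (LINT x:K|lborel. f x)"
    if k: "k \<le> m" for k
  proof -
    let ?J = "LINT x:K|lborel. f (F k x)"
    have "0 \<le> ?J"
      by (intro set_integral_ge_0) (auto intro: f0 FK k)
    then have "(1 / real (m + 2)) ^ 3 * ?J \<le> node m k ^ 3 * ?J"
      using node_bounds[OF k] by (intro mult_right_mono power_mono) auto
    also have "\<dots> \<le> (LINT x:K|lborel. f x)"
      unfolding F_def using nd[OF k]
      by (intro integral_homothety_le K_compact K_convex centroid_in_K cf f0)
    finally show ?thesis
      by (simp add: power_divide field_simps)
  qed
  have "(LINT x:K|lborel. (p x)\<^sup>2) \<le> (LINT x:K|lborel. S * E * (\<Sum>k\<le>m. f (F k x)))"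
    by (intro set_integral_mono set_integrable_compact K_compact pt continuous_intros cfF
        poly_space_continuous_on[OF p])
  also have "\<dots> = S * E * (\<Sum>k\<le>m. LINT x:K|lborel. f (F k x))"
    by (simp add: set_integral_sum_compact[OF K_compact cfF])
  also have "\<dots> \<le> S * E * (\<Sum>k\<le>m. real (m + 2) ^ 3 * (LINT x:K|lborel. f x))"
    using S E by (intro mult_left_mono sum_mono hom) auto
  also have "\<dots> = weight_const m * (LINT x:K|lborel. f x)"
    by (simp add: weight_const_def S_def E_def mult_ac)
  also have "(LINT x:K|lborel. f x) = (LINT x:K|lborel. weight i x * (p x)\<^sup>2)"
    by (intro set_lebesgue_integral_cong) (auto simp: f_def P compact_imp_closed K_compact)
  finally show ?thesis .
qed

section \<open>Shape regularity and the face normals\<close>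

text \<open>A barycentric coordinate varies by at most \<open>1\<close> along the diameter of a ball in \<open>K\<close> that is
  parallel to its gradient.\<close>

lemma norm_grad_le:
  assumes ball: "cball c \<rho> \<subseteq> K" and \<rho>: "0 < \<rho>" and i: "i \<le> 3"
  shows "2 * \<rho> * norm (grad i) \<le> 1"
proof -
  define d where "d = (\<rho> / norm (grad i)) *\<^sub>R grad i"
  have "norm d = \<rho>"
    using grad_nonzero[OF i] \<rho> by (simp add: d_def)
  then have "c + d \<in> K" "c - d \<in> K"
    using ball by (auto simp: dist_norm subset_iff)
  then have "barycentric a i (c + d) - barycentric a i (c - d) \<le> 1"
    using barycentric_le_1[of "c + d" i] barycentric_nonneg[of "c - d" i] i by linarith
  then have "grad i \<bullet> (2 *\<^sub>R d) \<le> 1"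
    by (simp add: barycentric_diff[OF i] scaleR_2)
  moreover have "grad i \<bullet> d = \<rho> * norm (grad i)"
    using grad_nonzero[OF i] by (simp add: d_def dot_square_norm power2_eq_square)
  ultimately show ?thesis by simp
qed

text \<open>In the expansion over the edges at vertex \<open>0\<close>, the edges are at most as long as the
  diameter, and the coefficients are the normal components scaled by the gradients, which the
  inscribed ball bounds.\<close>

lemma norm_le_normal_components:
  assumes ball: "cball c \<rho> \<subseteq> K" and \<rho>: "0 < \<rho>"
  shows "norm z \<le> diameter K / (2 * \<rho>) * (\<Sum>j=1..3. \<bar>outward_normal a j \<bullet> z\<bar>)"
proof -
  have "norm z = norm (\<Sum>j=1..3. (grad j \<bullet> z) *\<^sub>R (a j - a 0))"
    using grad_expansion[of z] by simp
  also have "\<dots> \<le> (\<Sum>j=1..3. norm ((grad j \<bullet> z) *\<^sub>R (a j - a 0)))"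
    by (rule norm_sum)
  also have "\<dots> \<le> (\<Sum>j=1..3. diameter K / (2 * \<rho>) * \<bar>outward_normal a j \<bullet> z\<bar>)"
  proof (rule sum_mono)
    fix j :: nat assume "j \<in> {1..3}"
    then have j: "j \<le> 3" by simp
    have "\<bar>grad j \<bullet> z\<bar> = norm (grad j) * \<bar>outward_normal a j \<bullet> z\<bar>"
      using grad_nonzero[OF j] by (simp add: outward_normal_eq[OF j] abs_mult)
    also have "\<dots> \<le> 1 / (2 * \<rho>) * \<bar>outward_normal a j \<bullet> z\<bar>"
      using norm_grad_le[OF ball \<rho> j] \<rho> by (intro mult_right_mono) (auto simp: field_simps)
    finally have 1: "\<bar>grad j \<bullet> z\<bar> \<le> 1 / (2 * \<rho>) * \<bar>outward_normal a j \<bullet> z\<bar>" .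
    have 2: "norm (a j - a 0) \<le> diameter K"
      unfolding dist_norm[symmetric]
      by (intro diameter_bounded_bound) (simp_all add: vertex_in_K compact_imp_bounded K_compact j)
    have "\<bar>grad j \<bullet> z\<bar> * norm (a j - a 0)
        \<le> 1 / (2 * \<rho>) * \<bar>outward_normal a j \<bullet> z\<bar> * diameter K"
      using \<rho> by (intro mult_mono 1 2) auto
    then show "norm ((grad j \<bullet> z) *\<^sub>R (a j - a 0))
        \<le> diameter K / (2 * \<rho>) * \<bar>outward_normal a j \<bullet> z\<bar>"
      by (simp add: mult_ac)
  qed
  finally show ?thesis
    by (simp add: sum_distrib_left)
qed

text \<open>Some ball comes within a factor \<open>2\<close> of the supremum that defines the inball diameter, because
  that supremum is positive; hence the factor \<open>4\<close> instead of \<open>2\<close>.\<close>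

lemma large_inscribed_ball:
  assumes reg: "diameter K \<le> \<sigma> * inball_diameter K"
  obtains c \<rho> where "0 < \<rho>" "cball c \<rho> \<subseteq> K" "diameter K \<le> 4 * \<bar>\<sigma>\<bar> * \<rho>"
proof -
  define R where "R = {(x :: real^3, \<rho> :: real). 0 \<le> \<rho> \<and> cball x \<rho> \<subseteq> K}"
  have inball: "inball_diameter K = (SUP (x, \<rho>)\<in>R. 2 * \<rho>)"
    by (simp add: inball_diameter_def R_def)
  have R0: "(a 0, 0) \<in> R"
    by (simp add: R_def vertex_in_K)
  have "2 * \<rho> \<le> diameter K" if "(x, \<rho>) \<in> R" for x \<rho>
    using that diameter_subset[of "cball x \<rho>" K] compact_imp_bounded[OF K_compact]
    by (auto simp: R_def diameter_cball)
  then have "bdd_above ((\<lambda>(x, \<rho>). 2 * \<rho>) ` R)"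
    by (intro bdd_aboveI[of _ "diameter K"]) auto
  then have "0 \<le> inball_diameter K"
    unfolding inball using R0 by (intro cSUP_upper2[of _ _ "(a 0, 0)"]) auto
  then have abs: "diameter K \<le> \<bar>\<sigma>\<bar> * inball_diameter K"
    using reg by (meson abs_ge_self mult_right_mono order_trans)
  with diameter_pos have \<sigma>: "0 < \<bar>\<sigma>\<bar>" by (cases "\<sigma> = 0") auto
  have "\<exists>(x, \<rho>)\<in>R. diameter K \<le> 4 * \<bar>\<sigma>\<bar> * \<rho>"
  proof (rule ccontr)
    assume "\<not> ?thesis"
    then have *: "4 * \<bar>\<sigma>\<bar> * \<rho> \<le> diameter K" if "(x, \<rho>) \<in> R" for x \<rho>
      using that by force
    have "inball_diameter K \<le> diameter K / (2 * \<bar>\<sigma>\<bar>)"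
      unfolding inball using R0 \<sigma> *
      by (intro cSUP_least) (auto simp: field_simps)
    then have "\<bar>\<sigma>\<bar> * inball_diameter K \<le> diameter K / 2"
      using \<sigma> by (simp add: field_simps)
    with abs diameter_pos show False by simp
  qed
  then obtain x \<rho> where x: "(x, \<rho>) \<in> R" "diameter K \<le> 4 * \<bar>\<sigma>\<bar> * \<rho>"
    by blast
  with diameter_pos have "\<rho> \<noteq> 0" by auto
  with x show thesis
    by (intro that[of \<rho> x]) (auto simp: R_def)
qed

text \<open>The factor is \<open>12 = 3 \<sqdot> 2\<^sup>2\<close>, with \<open>3\<close> from the Cauchy-Schwarz inequality for three terms. The
  summand \<open>1\<close> only makes the constant positive for every \<open>\<sigma>\<close>.\<close>

lemma norm_sq_le_normal_components:
  assumes reg: "diameter K \<le> \<sigma> * inball_diameter K"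
  shows "(norm z)\<^sup>2 \<le> 12 * (\<sigma>\<^sup>2 + 1) * (\<Sum>j=1..3. (outward_normal a j \<bullet> z)\<^sup>2)"
proof -
  let ?n = "\<lambda>j. outward_normal a j \<bullet> z"
  obtain c \<rho> where \<rho>: "0 < \<rho>" "cball c \<rho> \<subseteq> K" "diameter K \<le> 4 * \<bar>\<sigma>\<bar> * \<rho>"
    using large_inscribed_ball[OF reg] by blast
  have "norm z \<le> diameter K / (2 * \<rho>) * (\<Sum>j=1..3. \<bar>?n j\<bar>)"
    by (rule norm_le_normal_components[OF \<rho>(2,1)])
  also have "\<dots> \<le> 2 * \<bar>\<sigma>\<bar> * (\<Sum>j=1..3. \<bar>?n j\<bar>)"
    using \<rho> by (intro mult_right_mono sum_nonneg) (auto simp: field_simps)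
  finally have "(norm z)\<^sup>2 \<le> (2 * \<bar>\<sigma>\<bar> * (\<Sum>j=1..3. \<bar>?n j\<bar>))\<^sup>2"
    by (intro power_mono) auto
  also have "\<dots> = 4 * \<sigma>\<^sup>2 * (\<Sum>j=1..3. 1 * \<bar>?n j\<bar>)\<^sup>2"
    by (simp add: power_mult_distrib)
  also have "\<dots> \<le> 4 * \<sigma>\<^sup>2 * ((\<Sum>j::nat=1..3. 1\<^sup>2) * (\<Sum>j=1..3. \<bar>?n j\<bar>\<^sup>2))"
    by (intro mult_left_mono Cauchy_Schwarz_ineq_sum) auto
  also have "\<dots> = 12 * \<sigma>\<^sup>2 * (\<Sum>j=1..3. (?n j)\<^sup>2)"
    by simp
  also have "\<dots> \<le> 12 * (\<sigma>\<^sup>2 + 1) * (\<Sum>j=1..3. (?n j)\<^sup>2)"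
    by (intro mult_right_mono sum_nonneg) auto
  finally show ?thesis .
qed

section \<open>The inf-sup condition\<close>

text \<open>The test function is \<open>v = \<Sum>\<^sub>i (n\<^sub>i \<bullet> q) b\<^sub>i\<close>, which turns \<open>v \<bullet> q\<close> into the weighted sum of
  the squares \<open>(n\<^sub>i \<bullet> q)\<^sup>2\<close>. The weights can be dropped in the integral by the weighted norm
  estimate, and the unweighted sum controls \<open>q\<close> by assumption. Conversely each of the three terms
  of \<open>v\<close> is pointwise at most \<open>q\<close> in norm.\<close>

lemma inf_sup_witness:
  assumes q: "q \<in> D_space r K" "q \<noteq> (\<lambda>_. 0)" and A: "0 < A"
    and stab: "\<And>z. (norm z)\<^sup>2 \<le> A * (\<Sum>j=1..3. (outward_normal a j \<bullet> z)\<^sup>2)"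
  obtains v where "v \<in> B_curl_space r a K" "v \<noteq> (\<lambda>_. 0)"
    "1 / (3 * A * weight_const (r - 1)) \<le> L2_inner K v q / (L2_norm K v * L2_norm K q)"
proof -
  define p where "p i x = outward_normal a i \<bullet> q x" for i x
  define v where "v x = (\<Sum>i=1..3. p i x *\<^sub>R curl_bubble a i x)" for x
  define C where "C = weight_const (r - 1)"
  have C: "0 < C" by (simp add: C_def weight_const_pos)
  have p: "p i \<in> poly_space (r - 1) K" for i
    unfolding p_def[abs_def] by (rule D_space_inner_const[OF q(1)])
  have cp: "continuous_on K (p i)" for i
    by (rule poly_space_continuous_on[OF p])
  have cq: "continuous_on K q"
    by (rule D_space_continuous_on[OF q(1)])
  have cv: "continuous_on K v"
    unfolding v_def[abs_def] curl_bubble_eq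
    by (intro continuous_intros cp continuous_on_weight)
  have int: "set_integrable lborel K g" if "continuous_on K g" for g :: "real^3 \<Rightarrow> real"
    by (rule set_integrable_compact[OF K_compact that])
  have vB: "v \<in> B_curl_space r a K"
  proof -
    have "{1..3::nat} = {1, 2, 3}" by auto
    then have "v = (\<lambda>x. p 1 x *\<^sub>R curl_bubble a 1 x + p 2 x *\<^sub>R curl_bubble a 2 x
        + p 3 x *\<^sub>R curl_bubble a 3 x)"
      by (simp add: v_def[abs_def] add.assoc)
    then show ?thesis
      unfolding B_curl_space_def using p by blast
  qed
  have q_pos: "0 < L2_norm K q"
  proof -
    have "L2_norm K q \<noteq> 0"
      using L2_norm_eq_0_imp_eq_0[OF K_compact closure_interior_K cq D_space_eq_0_outside[OF q(1)]] q(2)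
      by blast
    with L2_norm_nonneg[of K q] show ?thesis by simp
  qed
  have vq: "v x \<bullet> q x = (\<Sum>i=1..3. weight i x * (p i x)\<^sup>2)" for x
    by (simp add: v_def curl_bubble_eq inner_sum_left p_def power2_eq_square mult_ac)
  have lower: "(L2_norm K q)\<^sup>2 \<le> A * C * L2_inner K v q"
  proof -
    have "(L2_norm K q)\<^sup>2 = (LINT x:K|lborel. (norm (q x))\<^sup>2)"
      by (simp add: L2_norm_sq L2_inner_def power2_norm_eq_inner)
    also have "\<dots> \<le> (LINT x:K|lborel. A * (\<Sum>i=1..3. (p i x)\<^sup>2))"
      unfolding p_def
      by (intro set_integral_mono int stab continuous_intros cq)
    also have "\<dots> = A * (\<Sum>i=1..3. LINT x:K|lborel. (p i x)\<^sup>2)"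
      by (simp add: set_integral_sum_compact[OF K_compact continuous_on_power[OF cp]])
    also have "\<dots> \<le> A * (\<Sum>i=1..3. C * (LINT x:K|lborel. weight i x * (p i x)\<^sup>2))"
      using A unfolding C_def by (intro mult_left_mono sum_mono poly_norm_le_weighted p) auto
    also have "\<dots> = A * C * (LINT x:K|lborel. (\<Sum>i=1..3. weight i x * (p i x)\<^sup>2))"
      by (simp add: set_integral_sum_compact[OF K_compact
            continuous_on_mult[OF continuous_on_weight continuous_on_power[OF cp]]]
          sum_distrib_left mult.assoc)
    also have "\<dots> = A * C * L2_inner K v q"
      by (simp add: L2_inner_def vq)
    finally show ?thesis .
  qed
  have upper: "L2_norm K v \<le> 3 * L2_norm K q"
  proof (rule power2_le_imp_le)
    have pt: "v x \<bullet> v x \<le> 9 * (q x \<bullet> q x)" if x: "x \<in> K" for x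
    proof -
      have "norm (v x) \<le> (\<Sum>i=1..3. norm (p i x *\<^sub>R curl_bubble a i x))"
        unfolding v_def by (rule norm_sum)
      also have "\<dots> \<le> (\<Sum>i::nat=1..3. norm (q x))"
      proof (rule sum_mono)
        fix i :: nat assume "i \<in> {1..3}"
        then have i: "i \<le> 3" by simp
        have "norm (p i x *\<^sub>R curl_bubble a i x) = \<bar>p i x\<bar> * weight i x"
          by (simp add: curl_bubble_eq norm_outward_normal[OF i] weight_nonneg[OF x] abs_mult)
        also have "\<dots> \<le> norm (q x) * 1"
          using Cauchy_Schwarz_ineq2[of "outward_normal a i" "q x"]
          by (intro mult_mono) (simp_all add: p_def norm_outward_normal[OF i] weight_nonneg[OF x] weight_le_1[OF x])
        finally show "norm (p i x *\<^sub>R curl_bubble a i x) \<le> norm (q x)" by simp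
      qed
      finally have "(norm (v x))\<^sup>2 \<le> (3 * norm (q x))\<^sup>2"
        by (intro power_mono) auto
      then show ?thesis
        by (simp add: power_mult_distrib power2_norm_eq_inner)
    qed
    have "(L2_norm K v)\<^sup>2 \<le> (LINT x:K|lborel. 9 * (q x \<bullet> q x))"
      unfolding L2_norm_sq L2_inner_def by (intro set_integral_mono int continuous_intros cv cq pt)
    also have "\<dots> = (3 * L2_norm K q)\<^sup>2"
      by (simp add: power_mult_distrib L2_norm_sq L2_inner_def)
    finally show "(L2_norm K v)\<^sup>2 \<le> (3 * L2_norm K q)\<^sup>2" .
  qed (use q_pos in simp)
  have vq_pos: "0 < L2_inner K v q"
  proof -
    have "0 < A * C * L2_inner K v q"
      using lower q_pos by (meson less_le_trans zero_less_power)
    then show ?thesis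
      using mult_pos_pos[OF A C] by (rule zero_less_mult_pos)
  qed
  have v_nz: "v \<noteq> (\<lambda>_. 0)"
    using vq_pos by (auto simp: L2_inner_def set_lebesgue_integral_def)
  have v_out: "v x = 0" if "x \<notin> K" for x
    using poly_space_eq_0_outside[OF p that] by (simp add: v_def)
  have v_pos: "0 < L2_norm K v"
  proof -
    have "L2_norm K v \<noteq> 0"
      using L2_norm_eq_0_imp_eq_0[OF K_compact closure_interior_K cv v_out] v_nz by blast
    with L2_norm_nonneg[of K v] show ?thesis by simp
  qed
  have "L2_norm K v * L2_norm K q \<le> 3 * (L2_norm K q)\<^sup>2"
    using mult_right_mono[OF upper, of "L2_norm K q"] q_pos by (simp add: power2_eq_square)
  also have "\<dots> \<le> 3 * A * C * L2_inner K v q"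
    using lower by simp
  finally have "1 / (3 * A * C) \<le> L2_inner K v q / (L2_norm K v * L2_norm K q)"
    using A C v_pos q_pos by (simp add: field_simps)
  with vB v_nz show thesis
    unfolding C_def by (rule that)
qed

end

text \<open>The bound of the witness lemma depends on \<open>r\<close> and \<open>\<sigma>\<close> only, so it serves all tetrahedra of all
  shape-regular triangulations and all vertex numberings at once.\<close>

theorem lemma4p1:
  fixes r :: nat and \<sigma> :: real
  assumes "r \<ge> 1"
  shows "\<exists>c>0. \<forall>\<Omega> \<T>. triangulation_of \<Omega> \<T> \<and> shape_regular \<sigma> \<T> \<longrightarrow>
           (\<forall>K\<in>\<T>. \<forall>a. tetrahedron_vertices a K \<longrightarrow>
              (INF q\<in>D_space r K - {\<lambda>_. 0}. SUP v\<in>B_curl_space r a K - {\<lambda>_. 0}.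
                 ereal (L2_inner K v q / (L2_norm K v * L2_norm K q))) \<ge> ereal c)"
proof -
  define A where "A = 12 * (\<sigma>\<^sup>2 + 1)"
  have A: "0 < A" by (simp add: A_def add_nonneg_pos)
  define c where "c = 1 / (3 * A * weight_const (r - 1))"
  have "0 < c"
    using A weight_const_pos by (simp add: c_def)
  moreover have "ereal c \<le> (INF q\<in>D_space r K - {\<lambda>_. 0}. SUP v\<in>B_curl_space r a K - {\<lambda>_. 0}.
      ereal (L2_inner K v q / (L2_norm K v * L2_norm K q)))"
    if reg: "shape_regular \<sigma> \<T>" "K \<in> \<T>" and a: "tetrahedron_vertices a K" for \<T> K a
  proof (rule INF_greatest)
    interpret tetrahedron a K by unfold_locales (rule a)
    fix q assume q: "q \<in> D_space r K - {\<lambda>_. 0}"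
    have "diameter K \<le> \<sigma> * inball_diameter K"
      using reg by (auto simp: shape_regular_def)
    note stab = norm_sq_le_normal_components[OF this, folded A_def]
    obtain v where "v \<in> B_curl_space r a K - {\<lambda>_. 0}"
      "c \<le> L2_inner K v q / (L2_norm K v * L2_norm K q)"
      using inf_sup_witness[OF _ _ A stab, of q r] q unfolding c_def by blast
    then show "ereal c \<le> (SUP v\<in>B_curl_space r a K - {\<lambda>_. 0}.
        ereal (L2_inner K v q / (L2_norm K v * L2_norm K q)))"
      by (intro SUP_upper2) auto
  qed
  ultimately show ?thesis by blast
qed

end
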